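(* Let $d,n\in\mathbb{N}$, let $S$ be an essentially non-negative real $d\times d$ matrix, $[a,b]\subset\mathbb{R}$ a finite interval, $\mu$ Lebesgue measure on $[a,b]$, $\omega_1,\dots,\omega_d$ moduli of continuity, $Q$ a set of $n$ points of $[a,b]$, $e\in\mathbb{R}^d_+$, $e_1,\dots,e_d\in\mathbb{R}^n_+$. For $i,j=1,\dots,d$ let $k_{ij}(t)$, $t\in[a,b]$, be the entry of the matrix $e^{S(t-a)}$ in the $i$th row and $j$th column, and define $B_{ij}:\mathbb{R}\to C_\mu([a,b])$ and $C_{ij}:B_\mu([a,b])\to C_\mu([a,b])$ by $$(B_{ij}x)(t)=k_{ij}(t)\,x,\qquad (C_{ij}x)(t)=\int_a^t k_{ij}(u)\,x(u)\,d\mu(u),\qquad t\in[a,b].$$ Let $\overline B=(B_{ij})$, $\overline C=(C_{ij})$ be the corresponding operator matrices and $\overline A=(\overline B\ \overline C)$, so that $\overline A(p,\overline q)=\overline Bp+\overline C\,\overline q$, i.e. $$(\overline A(p,\overline q))(t)=e^{S(t-a)}p+\int_a^te^{S(u-a)}\,\overline q(u)\,d\mu(u),\qquad t\in[a,b].$$ Let $\overline W=W_1\times W_2$ with $W_1=\mathbb{R}^d$, $W_2=H^{\omega_1}_\mu([a,b])\times\dots\times H^{\omega_d}_\mu([a,b])$; $\overline I=\mathrm{diag}(I_1,I_2)$ with $I_1=id_{\mathbb{R}^d}$, $I_2=\mathrm{diag}(I_Q,\dots,I_Q)$ ($d$ copies); $\overline U=U_1\times U_2$ with $U_1=U_e$,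 $U_2=U_{e_1}\times\dots\times U_{e_d}$; $L_1=id_{\mathbb{R}^d}$, $L_2=\mathrm{diag}(L_{\omega_1,Q,e_1},\dots,L_{\omega_d,Q,e_d})$, $\overline L=\mathrm{diag}(L_1,L_2)$; $\tau_1=e$, $\tau_2=(\tau_{\omega_1,Q,e_1},\dots,\tau_{\omega_d,Q,e_d})^T$, $\overline\tau=\tau_1\times\tau_2$. For $i=1,\dots,d$ let $Y_i\subset\mathfrak{M}([a,b],\mu)$ be a normed lattice containing $B_\mu([a,b])$, and let $\psi$ be a monotone norm on $\mathbb{R}^d$. Then $\Phi=\overline A\,\overline L$ is the optimal method of recovery of the operator $\overline A$ on the class $\overline W$ based on information $\overline I$ with $\overline U$-error, and, furthermore, $$\mathcal{E}_\psi(\overline A;\overline W;\overline I;\overline U)=\mathcal{E}_\psi(\overline A;\overline W;\overline I;\overline U;\Phi)=\|\overline A\,\overline\tau\|_\psi=\|\overline Be+\overline C\tau_2\|_\psi.$$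
   Context: The operator $\overline A$ is the one by which the authors represent the solution of the initial value problem $\overline x'(t)=S\overline x(t)+\overline q(t)$, $t\in[a,b]$, $\overline x(a)=p$; the claim concerns $\overline A$ as given by the displayed formulas. A square matrix is essentially non-negative if all its off-diagonal entries are non-negative; $e^M=\sum_{j\ge0}M^j/j!$. $B_\mu([a,b])$ and $C_\mu([a,b])$ are the sets of $\mu$-essentially bounded and of $\mu$-a.e. continuous functions on $[a,b]$, respectively. $\mathbb{R}_+=[0,\infty)$. A modulus of continuity is a continuous non-decreasing $\omega:\mathbb{R}_+\to\mathbb{R}_+$ with $\omega(0)=0$ and $\omega(t'+t'')\le\omega(t')+\omega(t'')$. $H^\omega_\mu([a,b])=\{x:[a,b]\to\mathbb{R}:|x(t')-x(t'')|\le\omega(|t'-t''|)\ \forall t',t''\}$. For a set of points $Q=\{s_1,\dots,s_n\}$ and $\varepsilon=(\varepsilon_1,\dots,\varepsilon_n)\in\mathbb{R}^n_+$: $I_Qx=(x(s_1),\dots,x(s_n))$; $\tau_{\omega,Q,\varepsilon}(t)=\min_{1\le j\le n}(\varepsilon_j+\omega(|t-s_j|))$; $\Pi'_j=\{t\in[a,b]:\tau_{\omega,Q,\varepsilon}(t)=\varepsilon_j+\omega(|t-s_j|)\}$, $\Pi_1=\Pi'_1$, $\Pi_j=\Pi'_j\setminus\bigcup_{r<j}\Pi_r$; $L_{\omega,Q,\varepsilon}:\mathbb{R}^n\to B_\mu([a,b])$, $L_{\omega,Q,\varepsilon}z(t)=z_j$ for $t\in\Pi_j$. For $\varepsilon\in\mathbb{R}^r_+$,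 $U_\varepsilon=[-\varepsilon_1,\varepsilon_1]\times\dots\times[-\varepsilon_r,\varepsilon_r]$. $\mathfrak{M}([a,b],\mu)$ is the space of measurable a.e. finite functions modulo a.e. equality, ordered by $x'\prec x''$ iff $x'\le x''$ a.e. A normed lattice $Y\subset\mathfrak{M}([a,b],\mu)$ is a normed space which is a vector lattice for the inherited order with $|x|\prec|y|\Rightarrow\|x\|_Y\le\|y\|_Y$. The norm $\psi$ is monotone if $\psi(\alpha)\le\psi(\beta)$ whenever $0\le\alpha_i\le\beta_i$ for all $i$. On $\overline Y=Y_1\times\dots\times Y_d$, $\|\overline y\|_\psi=\psi(\|y_1\|_{Y_1},\dots,\|y_d\|_{Y_d})$. A method of recovery is an arbitrary map $\Phi:\mathbb{R}^d\times(\mathbb{R}^n)^d\to\overline Y$; $\mathcal{E}_\psi(\overline A;\overline W;\overline I;\overline U;\Phi)=\sup_{\overline x\in\overline W}\sup_{\overline z\in\overline I\,\overline x+\overline U}\|\overline A\,\overline x-\Phi\overline z\|_\psi$; $\mathcal{E}_\psi(\overline A;\overline W;\overline I;\overline U)$ is its infimum over $\Phi$; a method is optimal if it attains this infimum. *)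

theory Defs
  imports "HOL-Analysis.Analysis"
begin

definition ess_nonneg :: "real^'d^'d \<Rightarrow> bool" where
  "ess_nonneg S \<longleftrightarrow> (\<forall>i j. i \<noteq> j \<longrightarrow> 0 \<le> S $ i $ j)"

text \<open>Multiplication on the vector type is componentwise, so the library's power and \<open>exp\<close>
  do not give the matrix power and the matrix exponential.\<close>

primrec mat_pow :: "real^'d^'d \<Rightarrow> nat \<Rightarrow> real^'d^'d" where
  "mat_pow M 0 = mat 1"
| "mat_pow M (Suc n) = M ** mat_pow M n"

definition mat_exp :: "real^'d^'d \<Rightarrow> real^'d^'d" where
  "mat_exp M = (\<Sum>n. (1 / fact n) *\<^sub>R mat_pow M n)"

definition modulus_of_continuity :: "(real \<Rightarrow> real) \<Rightarrow> bool" where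
  "modulus_of_continuity \<omega> \<longleftrightarrow>
     (\<forall>t\<ge>0. 0 \<le> \<omega> t) \<and> continuous_on {0..} \<omega> \<and> mono_on {0..} \<omega> \<and> \<omega> 0 = 0 \<and>
     (\<forall>t\<ge>0. \<forall>u\<ge>0. \<omega> (t + u) \<le> \<omega> t + \<omega> u)"

text \<open>A function on $[a,b]$ is represented by a function on the reals whose values outside
  $[a,b]$ play no role.\<close>

definition H_class :: "real \<Rightarrow> real \<Rightarrow> (real \<Rightarrow> real) \<Rightarrow> (real \<Rightarrow> real) set" where
  "H_class a b \<omega> = {x. \<forall>t\<in>{a..b}. \<forall>u\<in>{a..b}. \<bar>x t - x u\<bar> \<le> \<omega> \<bar>t - u\<bar>}"

definition B_space :: "real \<Rightarrow> real \<Rightarrow> (real \<Rightarrow> real) set" where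
  "B_space a b = {x \<in> borel_measurable (lebesgue_on {a..b}).
                    \<exists>K. AE t in lebesgue_on {a..b}. \<bar>x t\<bar> \<le> K}"

definition sample :: "('n \<Rightarrow> real) \<Rightarrow> (real \<Rightarrow> real) \<Rightarrow> real^'n" where
  "sample s x = (\<chi> j. x (s j))"

definition tau :: "(real \<Rightarrow> real) \<Rightarrow> ('n::finite \<Rightarrow> real) \<Rightarrow> real^'n \<Rightarrow> real \<Rightarrow> real" where
  "tau \<omega> s \<epsilon> t = Min (range (\<lambda>j. \<epsilon> $ j + \<omega> \<bar>t - s j\<bar>))"

definition Pi' :: "real \<Rightarrow> real \<Rightarrow> (real \<Rightarrow> real) \<Rightarrow> ('n::finite \<Rightarrow> real) \<Rightarrow> real^'n \<Rightarrow> 'n \<Rightarrow> real set" where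
  "Pi' a b \<omega> s \<epsilon> j = {t \<in> {a..b}. tau \<omega> s \<epsilon> t = \<epsilon> $ j + \<omega> \<bar>t - s j\<bar>}"

text \<open>The linear order on the finite index type enumerates the points \<open>s\<^sub>1, \<dots>, s\<^sub>n\<close>; the parts below
  partition $[a,b]$ when \<open>P\<close> is \<open>Pi'\<close>, so the index in \<open>L_op\<close> is unique.\<close>

function disjoint_parts :: "('n::{finite,linorder} \<Rightarrow> 'a set) \<Rightarrow> 'n \<Rightarrow> 'a set" where
  "disjoint_parts P j = P j - (\<Union>r\<in>{..<j}. disjoint_parts P r)"
  by auto
termination
  by (relation "Wellfounded.measure (\<lambda>(P, j). card {..<j})") (auto intro!: psubset_card_mono)

declare disjoint_parts.simps [simp del]

definition L_op :: "real \<Rightarrow> real \<Rightarrow> (real \<Rightarrow> real) \<Rightarrow> ('n \<Rightarrow> real)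
    \<Rightarrow> real^('n::{finite,linorder}) \<Rightarrow> real^('n::{finite,linorder}) \<Rightarrow> real \<Rightarrow> real" where
  "L_op a b \<omega> s \<epsilon> z t =
     (if t \<in> {a..b} then z $ (THE j. t \<in> disjoint_parts (Pi' a b \<omega> s \<epsilon>) j) else 0)"

definition kern :: "real^'d^'d \<Rightarrow> real \<Rightarrow> 'd \<Rightarrow> 'd \<Rightarrow> real \<Rightarrow> real" where
  "kern S a i j t = mat_exp ((t - a) *\<^sub>R S) $ i $ j"

definition B_op :: "real^'d^'d \<Rightarrow> real \<Rightarrow> 'd \<Rightarrow> 'd \<Rightarrow> real \<Rightarrow> real \<Rightarrow> real" where
  "B_op S a i j x t = kern S a i j t * x"

definition C_op :: "real^'d^'d \<Rightarrow> real \<Rightarrow> real \<Rightarrow> 'd \<Rightarrow> 'd \<Rightarrow> (real \<Rightarrow> real) \<Rightarrow> real \<Rightarrow> real" where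
  "C_op S a b i j x t = (LINT u:{a..t}|lebesgue_on {a..b}. kern S a i j u * x u)"

definition op_matrix :: "('d::finite \<Rightarrow> 'd \<Rightarrow> 'x \<Rightarrow> real \<Rightarrow> real) \<Rightarrow> ('d \<Rightarrow> 'x) \<Rightarrow> 'd \<Rightarrow> real \<Rightarrow> real" where
  "op_matrix T x i t = (\<Sum>j\<in>UNIV. T i j (x j) t)"

definition B_bar :: "real^'d^'d \<Rightarrow> real \<Rightarrow> real^'d \<Rightarrow> 'd::finite \<Rightarrow> real \<Rightarrow> real" where
  "B_bar S a p = op_matrix (B_op S a) (\<lambda>j. p $ j)"

definition C_bar :: "real^'d^'d \<Rightarrow> real \<Rightarrow> real \<Rightarrow> ('d \<Rightarrow> real \<Rightarrow> real) \<Rightarrow> 'd::finite \<Rightarrow> real \<Rightarrow> real" where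
  "C_bar S a b = op_matrix (C_op S a b)"

definition A_bar :: "real^'d^'d \<Rightarrow> real \<Rightarrow> real \<Rightarrow> (real^'d) \<times> ('d \<Rightarrow> real \<Rightarrow> real)
    \<Rightarrow> 'd::finite \<Rightarrow> real \<Rightarrow> real" where
  "A_bar S a b = (\<lambda>(p, q) i t. B_bar S a p i t + C_bar S a b q i t)"

definition W_bar :: "real \<Rightarrow> real \<Rightarrow> ('d::finite \<Rightarrow> real \<Rightarrow> real)
    \<Rightarrow> ((real^'d) \<times> ('d \<Rightarrow> real \<Rightarrow> real)) set" where
  "W_bar a b \<omega> = UNIV \<times> {q. \<forall>i. q i \<in> H_class a b (\<omega> i)}"

definition I_bar :: "('n::finite \<Rightarrow> real) \<Rightarrow> (real^'d) \<times> ('d::finite \<Rightarrow> real \<Rightarrow> real)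
    \<Rightarrow> (real^'d) \<times> (real^'n^'d)" where
  "I_bar s = map_prod id (\<lambda>q. \<chi> i. sample s (q i))"

definition U_bar :: "real^'d \<Rightarrow> real^'n^'d \<Rightarrow> ((real^'d::finite) \<times> (real^'n::finite^'d)) set" where
  "U_bar e \<epsilon> = cbox (- e) e \<times> {v. \<forall>i. v $ i \<in> cbox (- (\<epsilon> $ i)) (\<epsilon> $ i)}"

definition L_bar :: "real \<Rightarrow> real \<Rightarrow> ('d::finite \<Rightarrow> real \<Rightarrow> real) \<Rightarrow> ('n \<Rightarrow> real)
    \<Rightarrow> real^('n::{finite,linorder})^'d \<Rightarrow> (real^'d) \<times> (real^('n::{finite,linorder})^'d) \<Rightarrow> (real^'d) \<times> ('d \<Rightarrow> real \<Rightarrow> real)" where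
  "L_bar a b \<omega> s \<epsilon> = map_prod id (\<lambda>z i. L_op a b (\<omega> i) s (\<epsilon> $ i) (z $ i))"

definition tau2 :: "('d::finite \<Rightarrow> real \<Rightarrow> real) \<Rightarrow> ('n::finite \<Rightarrow> real) \<Rightarrow> real^'n^'d
    \<Rightarrow> 'd \<Rightarrow> real \<Rightarrow> real" where
  "tau2 \<omega> s \<epsilon> i = tau (\<omega> i) s (\<epsilon> $ i)"

definition le_ae :: "real \<Rightarrow> real \<Rightarrow> (real \<Rightarrow> real) \<Rightarrow> (real \<Rightarrow> real) \<Rightarrow> bool" where
  "le_ae a b x y \<longleftrightarrow> (AE t in lebesgue_on {a..b}. x t \<le> y t)"

definition is_sup :: "real \<Rightarrow> real \<Rightarrow> (real \<Rightarrow> real) set \<Rightarrow> (real \<Rightarrow> real) \<Rightarrow> (real \<Rightarrow> real)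
    \<Rightarrow> (real \<Rightarrow> real) \<Rightarrow> bool" where
  "is_sup a b Y x y z \<longleftrightarrow> z \<in> Y \<and> le_ae a b x z \<and> le_ae a b y z \<and>
     (\<forall>w\<in>Y. le_ae a b x w \<and> le_ae a b y w \<longrightarrow> le_ae a b z w)"

text \<open>The space of classes of measurable functions modulo a.e. equality is handled through
  representatives: a subspace \<open>Y\<close> is a set of measurable functions that is closed under a.e.
  equality, and a norm on it is a function \<open>N\<close> on representatives that respects a.e. equality.
  Infima need no separate treatment, since they are negatives of suprema of negatives. The modulus
  of an element \<open>x\<close> is the supremum in \<open>Y\<close> of \<open>x\<close> and \<open>- x\<close>.\<close>

definition normed_lattice :: "real \<Rightarrow> real \<Rightarrow> (real \<Rightarrow> real) set \<Rightarrow> ((real \<Rightarrow> real) \<Rightarrow> real) \<Rightarrow> bool" where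
  "normed_lattice a b Y N \<longleftrightarrow>
     Y \<subseteq> borel_measurable (lebesgue_on {a..b}) \<and>
     (\<forall>x\<in>Y. \<forall>y\<in>borel_measurable (lebesgue_on {a..b}).
        (AE t in lebesgue_on {a..b}. x t = y t) \<longrightarrow> y \<in> Y \<and> N y = N x) \<and>
     (\<lambda>t. 0) \<in> Y \<and>
     (\<forall>x\<in>Y. \<forall>y\<in>Y. (\<lambda>t. x t + y t) \<in> Y \<and> N (\<lambda>t. x t + y t) \<le> N x + N y) \<and>
     (\<forall>c. \<forall>x\<in>Y. (\<lambda>t. c * x t) \<in> Y \<and> N (\<lambda>t. c * x t) = \<bar>c\<bar> * N x) \<and>
     (\<forall>x\<in>Y. 0 \<le> N x \<and> (N x = 0 \<longleftrightarrow> (AE t in lebesgue_on {a..b}. x t = 0))) \<and>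
     (\<forall>x\<in>Y. \<forall>y\<in>Y. \<exists>z. is_sup a b Y x y z) \<and>
     (\<forall>x\<in>Y. \<forall>y\<in>Y. \<forall>x' y'. is_sup a b Y x (\<lambda>t. - x t) x' \<and> is_sup a b Y y (\<lambda>t. - y t) y' \<and>
        le_ae a b x' y' \<longrightarrow> N x \<le> N y)"

definition is_norm :: "(real^'d \<Rightarrow> real) \<Rightarrow> bool" where
  "is_norm \<psi> \<longleftrightarrow> (\<forall>x. 0 \<le> \<psi> x \<and> (\<psi> x = 0 \<longleftrightarrow> x = 0)) \<and>
     (\<forall>c x. \<psi> (c *\<^sub>R x) = \<bar>c\<bar> * \<psi> x) \<and> (\<forall>x y. \<psi> (x + y) \<le> \<psi> x + \<psi> y)"

definition monotone_norm :: "(real^'d \<Rightarrow> real) \<Rightarrow> bool" where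
  "monotone_norm \<psi> \<longleftrightarrow> is_norm \<psi> \<and>
     (\<forall>\<alpha> \<beta>. (\<forall>i. 0 \<le> \<alpha> $ i \<and> \<alpha> $ i \<le> \<beta> $ i) \<longrightarrow> \<psi> \<alpha> \<le> \<psi> \<beta>)"

definition prod_space :: "('d \<Rightarrow> (real \<Rightarrow> real) set) \<Rightarrow> ('d \<Rightarrow> real \<Rightarrow> real) set" where
  "prod_space Y = {y. \<forall>i. y i \<in> Y i}"

definition prod_norm :: "('d \<Rightarrow> (real \<Rightarrow> real) \<Rightarrow> real) \<Rightarrow> (real^'d \<Rightarrow> real) \<Rightarrow> ('d \<Rightarrow> real \<Rightarrow> real) \<Rightarrow> real" where
  "prod_norm N \<psi> y = \<psi> (\<chi> i. N i (y i))"

definition methods :: "('d \<Rightarrow> (real \<Rightarrow> real) set) \<Rightarrow> ('z \<Rightarrow> 'd \<Rightarrow> real \<Rightarrow> real) set" where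
  "methods Y = {\<Phi>. \<forall>z. \<Phi> z \<in> prod_space Y}"

text \<open>Errors are extended reals because the supremum over the class may be infinite.\<close>

definition method_error :: "(('d \<Rightarrow> real \<Rightarrow> real) \<Rightarrow> real) \<Rightarrow> ('x \<Rightarrow> 'd \<Rightarrow> real \<Rightarrow> real) \<Rightarrow> 'x set
    \<Rightarrow> ('x \<Rightarrow> 'z::plus) \<Rightarrow> 'z set \<Rightarrow> ('z \<Rightarrow> 'd \<Rightarrow> real \<Rightarrow> real) \<Rightarrow> ereal" where
  "method_error nrm A W I U \<Phi> =
     (SUP x\<in>W. SUP z\<in>(\<lambda>u. I x + u) ` U. ereal (nrm (\<lambda>i t. A x i t - \<Phi> z i t)))"

definition optimal_error :: "('d \<Rightarrow> (real \<Rightarrow> real) set) \<Rightarrow> (('d \<Rightarrow> real \<Rightarrow> real) \<Rightarrow> real)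
    \<Rightarrow> ('x \<Rightarrow> 'd \<Rightarrow> real \<Rightarrow> real) \<Rightarrow> 'x set \<Rightarrow> ('x \<Rightarrow> 'z::plus) \<Rightarrow> 'z set \<Rightarrow> ereal" where
  "optimal_error Y nrm A W I U = (INF \<Phi>\<in>methods Y. method_error nrm A W I U \<Phi>)"

definition optimal_method :: "('d \<Rightarrow> (real \<Rightarrow> real) set) \<Rightarrow> (('d \<Rightarrow> real \<Rightarrow> real) \<Rightarrow> real)
    \<Rightarrow> ('x \<Rightarrow> 'd \<Rightarrow> real \<Rightarrow> real) \<Rightarrow> 'x set \<Rightarrow> ('x \<Rightarrow> 'z::plus) \<Rightarrow> 'z set
    \<Rightarrow> ('z \<Rightarrow> 'd \<Rightarrow> real \<Rightarrow> real) \<Rightarrow> bool" where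
  "optimal_method Y nrm A W I U \<Phi> \<longleftrightarrow>
     \<Phi> \<in> methods Y \<and> method_error nrm A W I U \<Phi> = optimal_error Y nrm A W I U"

end

theory Submission
  imports Defs
begin

text \<open>Since \<open>S\<close> is essentially non-negative, all kernels \<open>k\<^sub>i\<^sub>j\<close> are non-negative, so the operator \<open>A\<close> is
  positive. On the part of $[a,b]$ where \<open>L\<close> takes the value \<open>z\<^sub>j\<close>, the distance of \<open>x\<close> from \<open>L z\<close> is at
  most \<open>\<epsilon>\<^sub>j + \<omega>(|t - s\<^sub>j|) = \<tau>(t)\<close>; positivity and monotonicity of the norms turn this into the bound
  \<open>\<parallel>A \<tau>\<parallel>\<close> for the error of \<open>A L\<close>. Conversely, \<open>\<tau>\<close> and \<open>- \<tau>\<close> both lie in the class and both admit the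
  zero vector as information, so any method makes an error of at least \<open>\<parallel>A \<tau>\<parallel>\<close> on one of them.\<close>

section \<open>The matrix exponential of an essentially non-negative matrix\<close>

lemma mat_pow_scaleR: "mat_pow (c *\<^sub>R M) n = c ^ n *\<^sub>R mat_pow M n"
  by (induction n) (simp_all add: matrix_matrix_mult_def vec_eq_iff sum_distrib_left mult_ac)

text \<open>The sum of all absolute entries dominates every absolute row sum, so each further factor
  \<open>M\<close> costs at most one more factor of it. Such geometric growth lets a scalar
  exponential series dominate the entries.\<close>

lemma abs_mat_pow_entry_le:
  fixes M :: "real^'d::finite^'d"
  shows "\<bar>mat_pow M n $ i $ j\<bar> \<le> (\<Sum>i\<in>UNIV. \<Sum>j\<in>UNIV. \<bar>M $ i $ j\<bar>) ^ n"
proof (induction n arbitrary: i j)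
  case 0
  show ?case by (simp add: mat_def)
next
  case (Suc n)
  let ?K = "\<Sum>i\<in>UNIV. \<Sum>j\<in>UNIV. \<bar>M $ i $ j\<bar>"
  have "\<bar>mat_pow M (Suc n) $ i $ j\<bar> \<le> (\<Sum>k\<in>UNIV. \<bar>M $ i $ k\<bar> * \<bar>mat_pow M n $ k $ j\<bar>)"
    by (simp add: matrix_matrix_mult_def flip: abs_mult)
  also have "\<dots> \<le> (\<Sum>k\<in>UNIV. \<bar>M $ i $ k\<bar> * ?K ^ n)"
    by (intro sum_mono mult_left_mono Suc.IH) auto
  also have "\<dots> = (\<Sum>k\<in>UNIV. \<bar>M $ i $ k\<bar>) * ?K ^ n"
    by (simp add: sum_distrib_right)
  also have "\<dots> \<le> ?K * ?K ^ n"
    by (intro mult_right_mono member_le_sum[where f = "\<lambda>i. \<Sum>k\<in>UNIV. \<bar>M $ i $ k\<bar>"])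
       (auto intro!: sum_nonneg zero_le_power)
  finally show ?case by simp
qed

lemma summable_abs_mat_pow_entry:
  fixes M :: "real^'d::finite^'d"
  shows "summable (\<lambda>n. norm (mat_pow M n $ i $ j / fact n * x ^ n))"
proof (rule summable_comparison_test')
  let ?K = "\<Sum>i\<in>UNIV. \<Sum>j\<in>UNIV. \<bar>M $ i $ j\<bar>"
  show "summable (\<lambda>n. inverse (fact n) * (?K * \<bar>x\<bar>) ^ n)"
    by (rule summable_exp)
  show "norm (norm (mat_pow M n $ i $ j / fact n * x ^ n)) \<le> inverse (fact n) * (?K * \<bar>x\<bar>) ^ n"
    for n
    using mult_right_mono[OF abs_mat_pow_entry_le[of M n i j], of "\<bar>x\<bar> ^ n"]
    by (simp add: abs_mult power_abs field_simps)
qed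

text \<open>Convergence in each of the finitely many coordinates gives convergence of the matrix
  series, so entries may be taken termwise and the kernel becomes a power series in
  \<open>t - a\<close>.\<close>

lemma kern_sums:
  fixes S :: "real^'d::finite^'d"
  shows "(\<lambda>n. mat_pow S n $ i $ j / fact n * (t - a) ^ n) sums kern S a i j t"
proof -
  let ?f = "\<lambda>n. (1 / fact n) *\<^sub>R mat_pow ((t - a) *\<^sub>R S) n"
  have entry: "?f n $ i $ j = mat_pow S n $ i $ j / fact n * (t - a) ^ n" for n i j
    by (simp add: mat_pow_scaleR)
  define F where "F = (\<chi> i j. \<Sum>n. ?f n $ i $ j)"
  have s: "(\<lambda>n. ?f n $ i $ j) sums (F $ i $ j)" for i j
    unfolding F_def vec_lambda_beta entry
    by (intro summable_sums summable_norm_cancel[OF summable_abs_mat_pow_entry])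
  have "?f sums F"
    using s unfolding sums_def by (intro vec_tendstoI) simp
  then have "mat_exp ((t - a) *\<^sub>R S) = F"
    unfolding mat_exp_def by (rule sums_unique[symmetric])
  then show ?thesis
    using s unfolding kern_def entry by simp
qed

lemma continuous_on_kern: "continuous_on X (kern S a i j)"
  for S :: "real^'d::finite^'d"
proof -
  let ?c = "\<lambda>n. mat_pow S n $ i $ j / fact n"
  have "isCont (\<lambda>x. \<Sum>n. ?c n * x ^ n) x" for x
    by (rule isCont_powser_converges_everywhere)
       (rule summable_abs_mat_pow_entry[THEN summable_norm_cancel])
  then have "isCont (\<lambda>t. \<Sum>n. ?c n * (t - a) ^ n) t" for t
    by (rule isCont_o2[where f = "\<lambda>t. t - a", rotated]) (intro continuous_intros)
  moreover have "kern S a i j = (\<lambda>t. \<Sum>n. ?c n * (t - a) ^ n)"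
    using sums_unique[OF kern_sums] by (rule ext)
  ultimately show ?thesis
    by (metis continuous_at_imp_continuous_on)
qed

lemma matrix_mult_sum_right: "A ** sum f X = (\<Sum>x\<in>X. A ** f x)"
  for A :: "real^'d::finite^'d"
  by (induction X rule: infinite_finite_induct) (auto simp: matrix_add_ldistrib)

text \<open>The binomial theorem, available because a scalar matrix commutes with
  \<open>M\<close>.\<close>

lemma mat_pow_add_mat:
  fixes M :: "real^'d::finite^'d"
  shows "mat_pow (M + mat c) n = (\<Sum>k\<le>n. (of_nat (n choose k) * c ^ (n - k)) *\<^sub>R mat_pow M k)"
proof (induction n)
  case 0
  show ?case by simp
next
  case (Suc n)
  have add_mat_mult: "(M + mat c) ** A = M ** A + c *\<^sub>R A" for A :: "real^'d^'d"
    by (simp add: matrix_matrix_mult_def mat_def vec_eq_iff distrib_right sum.distrib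
        if_distrib[of "\<lambda>x. x * _"] cong: if_cong)
  have mult_scaleR: "M ** (r *\<^sub>R A) = r *\<^sub>R (M ** A)" for r and A :: "real^'d^'d"
    by (simp add: matrix_matrix_mult_def vec_eq_iff sum_distrib_left mult_ac)
  let ?P = "mat_pow M"
  \<comment> \<open>The re-indexed sum acquires a top term with coefficient
    \<open>n choose Suc n\<close>, which vanishes. In the shifted form Pascal's rule applies term by
    term.\<close>
  have shift: "(\<Sum>k\<le>n. (of_nat (n choose Suc k) * c ^ (n - k)) *\<^sub>R ?P (Suc k)) + c ^ Suc n *\<^sub>R ?P 0
      = (\<Sum>k\<le>n. (of_nat (n choose k) * c ^ (Suc n - k)) *\<^sub>R ?P k)"
    (is "?l = _")
  proof -
    have "?l = (\<Sum>k\<le>Suc n. (of_nat (n choose k) * c ^ (Suc n - k)) *\<^sub>R ?P k)"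
      by (subst sum.atMost_Suc_shift) (simp add: add.commute)
    then show ?thesis by simp
  qed
  have "mat_pow (M + mat c) (Suc n)
      = (\<Sum>k\<le>n. (of_nat (n choose k) * c ^ (n - k)) *\<^sub>R ?P (Suc k))
        + (\<Sum>k\<le>n. (of_nat (n choose k) * c ^ (Suc n - k)) *\<^sub>R ?P k)"
    by (simp add: Suc.IH add_mat_mult matrix_mult_sum_right mult_scaleR sum.distrib
        scaleR_sum_right Suc_diff_le mult_ac)
  also have "\<dots> = (\<Sum>k\<le>Suc n. (of_nat (Suc n choose k) * c ^ (Suc n - k)) *\<^sub>R ?P k)"
    unfolding shift[symmetric] sum.atMost_Suc_shift
    by (simp add: sum.distrib algebra_simps)
  finally show ?case .
qed

lemma mat_pow_nonneg:
  fixes M :: "real^'d::finite^'d"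
  assumes "\<And>i j. 0 \<le> M $ i $ j"
  shows "0 \<le> mat_pow M n $ i $ j"
  by (induction n arbitrary: i j)
     (auto simp: mat_def matrix_matrix_mult_def assms intro!: sum_nonneg)

text \<open>Writing \<open>S = M - c\<close> with a non-negative matrix \<open>M\<close>, the exponential of \<open>(t - a) S\<close> is the
  exponential of \<open>(t - a) M\<close> times the positive scalar \<open>exp (- c (t - a))\<close>.\<close>

lemma kern_nonneg:
  fixes S :: "real^'d::finite^'d"
  assumes "ess_nonneg S" and "a \<le> t"
  shows "0 \<le> kern S a i j t"
proof -
  \<comment> \<open>The sum dominates the modulus of every diagonal entry, so
    \<open>S + mat c\<close> has no negative entries.\<close>
  define c where "c = (\<Sum>i\<in>UNIV. \<bar>S $ i $ i\<bar>)"
  define M where "M = S + mat c"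
  define x where "x = t - a"
  have diag: "\<bar>S $ k $ k\<bar> \<le> c" for k
    unfolding c_def by (rule member_le_sum) auto
  have "0 \<le> M $ k $ l" for k l
    using assms(1) diag[of k] by (auto simp: M_def mat_def ess_nonneg_def)
  then have M: "0 \<le> mat_pow M n $ k $ l" for n k l
    by (rule mat_pow_nonneg)
  have S: "S = M + mat (- c)"
    by (simp add: M_def mat_def vec_eq_iff)
  let ?u = "\<lambda>k. mat_pow M k $ i $ j / fact k * x ^ k"
  let ?v = "\<lambda>k. inverse (fact k) * (- c * x) ^ k"
  \<comment> \<open>The binomial theorem turns the kernel series into the Cauchy product of the
    series of \<open>M\<close> and of \<open>exp (- c * x)\<close>, because
    \<open>n choose k\<close> divided by \<open>fact n\<close> is
    \<open>1 / (fact k * fact (n - k))\<close>.\<close>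
  have term_eq: "mat_pow S n $ i $ j / fact n * (t - a) ^ n = (\<Sum>k\<le>n. ?u k * ?v (n - k))" for n
  proof -
    have "mat_pow S n $ i $ j / fact n * (t - a) ^ n
        = (\<Sum>k\<le>n. of_nat (n choose k) * (- c) ^ (n - k) * mat_pow M k $ i $ j / fact n * x ^ n)"
      by (simp add: S mat_pow_add_mat sum_component sum_distrib_right sum_divide_distrib x_def)
    also have "\<dots> = (\<Sum>k\<le>n. ?u k * ?v (n - k))"
    proof (rule sum.cong)
      fix k assume "k \<in> {..n}"
      then have "x ^ n = x ^ k * x ^ (n - k)" and "k \<le> n"
        by (simp_all flip: power_add)
      then show "of_nat (n choose k) * (- c) ^ (n - k) * mat_pow M k $ i $ j / fact n * x ^ n
          = ?u k * ?v (n - k)"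
        by (simp only: binomial_fact power_mult_distrib) (simp add: field_simps)
    qed simp
    finally show ?thesis .
  qed
  have "summable (\<lambda>k. norm (?v k))"
    using summable_norm_exp[of "- c * x"] by simp
  with summable_abs_mat_pow_entry
  have "(\<lambda>n. \<Sum>k\<le>n. ?u k * ?v (n - k)) sums ((\<Sum>k. ?u k) * (\<Sum>k. ?v k))"
    by (rule Cauchy_product_sums)
  then have "kern S a i j t = (\<Sum>k. ?u k) * (\<Sum>k. ?v k)"
    using kern_sums[of S i j t a] unfolding term_eq by (rule sums_unique2[rotated])
  also have "(\<Sum>k. ?v k) = exp (- c * x)"
    by (simp add: exp_def)
  finally have "kern S a i j t = (\<Sum>k. ?u k) * exp (- c * x)" .
  \<comment> \<open>Here \<open>a \<le> t\<close> enters: the powers of \<open>x\<close> are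
    non-negative.\<close>
  moreover have "0 \<le> (\<Sum>k. ?u k)"
    using M \<open>a \<le> t\<close> summable_abs_mat_pow_entry[THEN summable_norm_cancel]
    by (intro suminf_nonneg) (auto simp: x_def)
  ultimately show ?thesis by simp
qed

section \<open>Positivity of the solution operator\<close>

lemma continuous_on_imp_B_space:
  assumes "continuous_on {a..b} x"
  shows "x \<in> B_space a b"
proof -
  have "bounded (x ` {a..b})"
    by (intro compact_imp_bounded compact_continuous_image assms compact_Icc)
  then obtain K where "\<forall>t\<in>{a..b}. \<bar>x t\<bar> \<le> K"
    by (auto simp: bounded_iff)
  then have "AE t in lebesgue_on {a..b}. \<bar>x t\<bar> \<le> K"
    by (intro AE_I2) (simp add: space_lebesgue_on)
  moreover have "x \<in> borel_measurable (lebesgue_on {a..b})"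
    using assms by (rule continuous_imp_measurable_on_sets_lebesgue) simp
  ultimately show ?thesis
    unfolding B_space_def by blast
qed

lemma B_space_abs:
  assumes "x \<in> B_space a b"
  shows "(\<lambda>t. \<bar>x t\<bar>) \<in> B_space a b"
  using assms by (auto simp: B_space_def)

lemma B_space_diff:
  assumes "x \<in> B_space a b" and "y \<in> B_space a b"
  shows "(\<lambda>t. x t - y t) \<in> B_space a b"
proof -
  from assms obtain K L where "AE t in lebesgue_on {a..b}. \<bar>x t\<bar> \<le> K"
      "AE t in lebesgue_on {a..b}. \<bar>y t\<bar> \<le> L"
    by (auto simp: B_space_def)
  then have "AE t in lebesgue_on {a..b}. \<bar>x t - y t\<bar> \<le> K + L"
    by eventually_elim auto
  then show ?thesis
    using assms by (auto simp: B_space_def)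
qed

lemma integrable_kern_mult:
  fixes S :: "real^'d::finite^'d"
  assumes "x \<in> B_space a b"
  shows "integrable (lebesgue_on {a..b}) (\<lambda>u. kern S a i j u * x u)"
proof -
  interpret finite_measure "lebesgue_on {a..b}"
    by (rule finite_measure_lebesgue_on) simp
  have k: "kern S a i j \<in> B_space a b"
    by (intro continuous_on_imp_B_space continuous_on_kern)
  obtain K L where *: "AE u in lebesgue_on {a..b}. \<bar>kern S a i j u\<bar> \<le> K"
      "AE u in lebesgue_on {a..b}. \<bar>x u\<bar> \<le> L"
    using k assms by (auto simp: B_space_def)
  then have "AE u in lebesgue_on {a..b}. norm (kern S a i j u * x u) \<le> K * L"
    by eventually_elim (auto simp: abs_mult intro!: mult_mono)
  moreover have "(\<lambda>u. kern S a i j u * x u) \<in> borel_measurable (lebesgue_on {a..b})"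
    using k assms by (auto simp: B_space_def)
  ultimately show ?thesis
    by (rule integrable_const_bound)
qed

lemma C_op_integrable:
  fixes S :: "real^'d::finite^'d"
  assumes "x \<in> B_space a b" and "t \<le> b"
  shows "set_integrable (lebesgue_on {a..b}) {a..t} (\<lambda>u. kern S a i j u * x u)"
  unfolding set_integrable_def
  using assms
  by (intro integrable_mult_indicator integrable_kern_mult) (auto simp: sets_restrict_space_iff)

text \<open>An indefinite integral of an integrable function is continuous in its upper limit. Hence
  \<open>A_bar\<close> sends bounded data to continuous functions, which are bounded on the
  interval.\<close>

lemma continuous_on_C_op:
  fixes S :: "real^'d::finite^'d"
  assumes "x \<in> B_space a b"
  shows "continuous_on {a..b} (C_op S a b i j x)"
proof -
  have "C_op S a b i j x t = (LINT u|lebesgue_on {a..t}. kern S a i j u * x u)"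
    if "t \<in> {a..b}" for t
  proof -
    \<comment> \<open>Seeing this measure as a second restriction allows the indicator in the set
      integral to be traded for a smaller domain.\<close>
    have "lebesgue_on {a..t} = restrict_space (lebesgue_on {a..b}) {a..t}"
      using that by (simp add: restrict_restrict_space Int_absorb1)
    then show ?thesis
      unfolding C_op_def set_lebesgue_integral_def
      by (simp add: integral_restrict_space sets_restrict_space_iff)
  qed
  from continuous_on_cong[THEN iffD2, OF refl this
      indefinite_integral_continuous_real[OF integrable_kern_mult[OF assms]]]
  show ?thesis .
qed

lemma continuous_on_A_bar:
  assumes "\<And>i. q i \<in> B_space a b"
  shows "continuous_on {a..b} (A_bar S a b (p, q) i)"
  unfolding A_bar_def B_bar_def C_bar_def op_matrix_def B_op_def case_prod_conv
  by (intro continuous_intros continuous_on_kern continuous_on_C_op assms)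

lemma A_bar_B_space:
  assumes "\<And>i. q i \<in> B_space a b"
  shows "A_bar S a b (p, q) i \<in> B_space a b"
  by (intro continuous_on_imp_B_space continuous_on_A_bar assms)

lemma A_bar_uminus: "A_bar S a b (- p, \<lambda>j u. - q j u) i t = - A_bar S a b (p, q) i t"
  by (simp add: A_bar_def B_bar_def C_bar_def op_matrix_def B_op_def C_op_def sum_negf
      set_lebesgue_integral_def)

text \<open>Splitting the integral uses integrability, which boundedness of the data provides;
  \<open>t \<le> b\<close> keeps the range of integration inside the interval.\<close>

lemma A_bar_diff:
  assumes "\<And>i. q i \<in> B_space a b" and "\<And>i. q' i \<in> B_space a b" and "t \<le> b"
  shows "A_bar S a b (p, q) i t - A_bar S a b (p', q') i t
    = A_bar S a b (p - p', \<lambda>j u. q j u - q' j u) i t"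
  by (simp add: A_bar_def B_bar_def C_bar_def op_matrix_def B_op_def C_op_def sum_subtractf
      right_diff_distrib set_integral_diff C_op_integrable assms)

text \<open>After the triangle inequality for sums and integrals, non-negative kernels preserve
  pointwise bounds. Thus a bound for the error in the data becomes a bound for the error in the
  solution.\<close>

lemma abs_A_bar_le:
  assumes "ess_nonneg S" and t: "a \<le> t" "t \<le> b"
    and q: "\<And>i. q i \<in> B_space a b" and r: "\<And>i. r i \<in> B_space a b"
    and p_le: "\<And>i. \<bar>p $ i\<bar> \<le> e $ i" and q_le: "\<And>i u. u \<in> {a..b} \<Longrightarrow> \<bar>q i u\<bar> \<le> r i u"
  shows "\<bar>A_bar S a b (p, q) i t\<bar> \<le> A_bar S a b (e, r) i t"
proof -
  have "\<bar>B_bar S a p i t\<bar> \<le> B_bar S a e i t"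
    unfolding B_bar_def op_matrix_def B_op_def
    using assms(1,2) p_le
    by (intro order_trans[OF sum_abs] sum_mono) (simp add: abs_mult mult_left_mono kern_nonneg)
  moreover have "\<bar>C_bar S a b q i t\<bar> \<le> C_bar S a b r i t"
  proof -
    have "\<bar>C_op S a b i j (q j) t\<bar> \<le> C_op S a b i j (r j) t" for j
      unfolding C_op_def set_lebesgue_integral_def
    proof (rule order_trans[OF integral_abs_bound integral_mono])
      show "integrable (lebesgue_on {a..b})
          (\<lambda>u. \<bar>indicat_real {a..t} u *\<^sub>R (kern S a i j u * q j u)\<bar>)"
        using C_op_integrable[OF q t(2)] by (intro integrable_abs) (simp add: set_integrable_def)
      show "integrable (lebesgue_on {a..b})
          (\<lambda>u. indicat_real {a..t} u *\<^sub>R (kern S a i j u * r j u))"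
        using C_op_integrable[OF r t(2)] by (simp add: set_integrable_def)
      fix u assume "u \<in> space (lebesgue_on {a..b})"
      then show "\<bar>indicat_real {a..t} u *\<^sub>R (kern S a i j u * q j u)\<bar>
          \<le> indicat_real {a..t} u *\<^sub>R (kern S a i j u * r j u)"
        using q_le[of u j] kern_nonneg[OF assms(1), of a u i j]
        by (simp add: space_lebesgue_on abs_mult mult_left_mono indicator_def)
    qed
    then show ?thesis
      unfolding C_bar_def op_matrix_def
      by (intro order_trans[OF sum_abs] sum_mono)
  qed
  ultimately show ?thesis
    by (simp add: A_bar_def)
qed

section \<open>Moduli of continuity and piecewise constant recovery\<close>

text \<open>Monotonicity and subadditivity transfer the triangle inequality of the line to \<omega>.
  Composing \<omega> with the distance to a fixed point therefore gives a member of the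
  class.\<close>

lemma modulus_abs_diff_le:
  assumes "modulus_of_continuity \<omega>"
  shows "\<bar>\<omega> (\<bar>t - v\<bar>) - \<omega> (\<bar>u - v\<bar>)\<bar> \<le> \<omega> (\<bar>t - u\<bar>)"
proof -
  have *: "\<omega> \<bar>x - v\<bar> \<le> \<omega> \<bar>x - y\<bar> + \<omega> \<bar>y - v\<bar>" for x y
  proof -
    have "\<omega> \<bar>x - v\<bar> \<le> \<omega> (\<bar>x - y\<bar> + \<bar>y - v\<bar>)"
      using assms by (auto simp: modulus_of_continuity_def mono_on_def)
    also have "\<dots> \<le> \<omega> \<bar>x - y\<bar> + \<omega> \<bar>y - v\<bar>"
      using assms by (auto simp: modulus_of_continuity_def)
    finally show ?thesis .
  qed
  show ?thesis
    using *[of t u] *[of u t] unfolding abs_minus_commute[of u t] by linarith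
qed

lemma continuous_on_modulus:
  assumes "modulus_of_continuity \<omega>"
  shows "continuous_on X (\<lambda>t. \<omega> \<bar>t - u\<bar>)"
proof (rule continuous_on_compose2[of "{0..}" \<omega>])
  show "continuous_on {0..} \<omega>"
    using assms by (simp add: modulus_of_continuity_def)
  show "continuous_on X (\<lambda>t. \<bar>t - u\<bar>)"
    by (intro continuous_intros)
qed auto

text \<open>The increments are squeezed by \<omega>, which is continuous and vanishes at
  zero.\<close>

lemma H_class_continuous_on:
  assumes "modulus_of_continuity \<omega>" and "x \<in> H_class a b \<omega>"
  shows "continuous_on {a..b} x"
  unfolding continuous_on_def
proof
  fix u assume u: "u \<in> {a..b}"
  have "isCont (\<lambda>t. \<omega> \<bar>t - u\<bar>) u"
    using continuous_on_modulus[OF assms(1), of UNIV] by (simp add: continuous_on_eq_continuous_at)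
  then have lim: "((\<lambda>t. \<omega> \<bar>t - u\<bar>) \<longlongrightarrow> 0) (at u within {a..b})"
    using assms(1) by (auto simp: isCont_def modulus_of_continuity_def intro: tendsto_within_subset)
  have "\<forall>\<^sub>F t in at u within {a..b}. norm (x t - x u) \<le> \<omega> \<bar>t - u\<bar>"
    using assms(2) u by (auto simp: eventually_at_filter H_class_def)
  then have "((\<lambda>t. x t - x u) \<longlongrightarrow> 0) (at u within {a..b})"
    using lim by (rule Lim_null_comparison)
  then show "(x \<longlongrightarrow> x u) (at u within {a..b})"
    by (rule LIM_zero_cancel)
qed

lemma H_class_subset_B_space:
  assumes "modulus_of_continuity \<omega>"
  shows "H_class a b \<omega> \<subseteq> B_space a b"
  using H_class_continuous_on[OF assms] continuous_on_imp_B_space by blast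

lemma H_class_uminus: "x \<in> H_class a b \<omega> \<Longrightarrow> (\<lambda>t. - x t) \<in> H_class a b \<omega>"
  by (simp add: H_class_def abs_minus_commute)

lemma tau_le: "tau \<omega> s \<epsilon> t \<le> \<epsilon> $ j + \<omega> \<bar>t - s j\<bar>"
  by (simp add: tau_def)

lemma tau_attained: "\<exists>j. tau \<omega> s \<epsilon> t = \<epsilon> $ j + \<omega> \<bar>t - s j\<bar>"
proof -
  have "tau \<omega> s \<epsilon> t \<in> range (\<lambda>j. \<epsilon> $ j + \<omega> \<bar>t - s j\<bar>)"
    unfolding tau_def by (rule Min_in) auto
  then show ?thesis by blast
qed

lemma tau_nonneg:
  assumes "modulus_of_continuity \<omega>" and "\<And>j. 0 \<le> \<epsilon> $ j"
  shows "0 \<le> tau \<omega> s \<epsilon> t"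
  using tau_attained[of \<omega> s \<epsilon> t] assms by (auto simp: modulus_of_continuity_def)

text \<open>The competitor belonging to \<open>s j\<close> reduces to its noise level there, as
  \<omega> vanishes at zero. With \<open>tau_nonneg\<close>, this makes zero admissible information
  for \<open>tau\<close> and its negative.\<close>

lemma tau_sample_le:
  assumes "modulus_of_continuity \<omega>"
  shows "tau \<omega> s \<epsilon> (s j) \<le> \<epsilon> $ j"
  using tau_le[of \<omega> s \<epsilon> "s j" j] assms by (simp add: modulus_of_continuity_def)

text \<open>The competitor attaining the minimum at \<open>u\<close> also bounds the minimum at
  \<open>t\<close>, and its own two values differ by at most the modulus of the distance.\<close>

lemma tau_H_class:
  assumes "modulus_of_continuity \<omega>"
  shows "tau \<omega> s \<epsilon> \<in> H_class a b \<omega>"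
proof -
  have "tau \<omega> s \<epsilon> t - tau \<omega> s \<epsilon> u \<le> \<omega> \<bar>t - u\<bar>" for t u
  proof -
    obtain j where "tau \<omega> s \<epsilon> u = \<epsilon> $ j + \<omega> \<bar>u - s j\<bar>"
      using tau_attained by blast
    then show ?thesis
      using tau_le[of \<omega> s \<epsilon> t j] modulus_abs_diff_le[OF assms, of t "s j" u] by linarith
  qed
  then show ?thesis
    unfolding H_class_def by (auto simp: abs_le_iff) (metis abs_minus_commute)
qed

text \<open>Every point of \<open>P r\<close> lies in some part of index at most \<open>r\<close>,
  so removing the earlier parts amounts to removing the earlier sets.\<close>

lemma disjoint_parts_eq: "disjoint_parts P j = P j - (\<Union>r\<in>{..<j}. P r)"
proof -
  have mem_iff: "x \<in> disjoint_parts P r \<longleftrightarrow> x \<in> P r \<and> (\<forall>k<r. x \<notin> disjoint_parts P k)" for x r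
    by (subst disjoint_parts.simps) auto
  have "\<exists>k\<le>r. x \<in> disjoint_parts P k" if "x \<in> P r" for x r
    using mem_iff[of x r] that by (meson less_imp_le order_refl)
  moreover have "disjoint_parts P r \<subseteq> P r" for r
    using mem_iff by blast
  ultimately have "(\<Union>r\<in>{..<j}. disjoint_parts P r) = (\<Union>r\<in>{..<j}. P r)"
    by (fastforce intro: le_less_trans)
  then show ?thesis
    using disjoint_parts.simps[of P j] by simp
qed

text \<open>The part containing \<open>x\<close> is the one whose index is least among all
  \<open>j\<close> with \<open>x \<in> P j\<close>.\<close>

lemma ex1_disjoint_parts:
  fixes P :: "'n::{finite,linorder} \<Rightarrow> 'a set"
  assumes "x \<in> P i"
  shows "\<exists>!j. x \<in> disjoint_parts P j"
proof -
  define m where "m = Min {j. x \<in> P j}"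
  have "x \<in> P m"
    using Min_in[of "{j. x \<in> P j}"] assms by (auto simp: m_def)
  moreover have "x \<notin> P r" if "r < m" for r
  proof
    assume "x \<in> P r"
    then have "m \<le> r"
      unfolding m_def by (intro Min_le) auto
    with that show False by simp
  qed
  ultimately have m: "x \<in> disjoint_parts P m"
    by (simp add: disjoint_parts_eq)
  have "x \<notin> disjoint_parts P k" if "j < k" "x \<in> disjoint_parts P j" for j k
    using that by (auto simp: disjoint_parts_eq)
  then have "k = m" if "x \<in> disjoint_parts P k" for k
    using m that by (cases k m rule: linorder_cases) auto
  with m show ?thesis by blast
qed

lemma ex1_part:
  assumes "t \<in> {a..b}"
  shows "\<exists>!j. t \<in> disjoint_parts (Pi' a b \<omega> s \<epsilon>) j"
proof -
  obtain j where "t \<in> Pi' a b \<omega> s \<epsilon> j"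
    using assms tau_attained[of \<omega> s \<epsilon> t] by (auto simp: Pi'_def)
  then show ?thesis by (rule ex1_disjoint_parts)
qed

text \<open>One index serves both the recovered value and the minimum, because each disjoint part
  lies in the corresponding \<open>Pi'\<close>.\<close>

lemma L_op_eq:
  assumes "t \<in> {a..b}"
  obtains j where "L_op a b \<omega> s \<epsilon> z t = z $ j" and "tau \<omega> s \<epsilon> t = \<epsilon> $ j + \<omega> \<bar>t - s j\<bar>"
proof -
  obtain j where j: "t \<in> disjoint_parts (Pi' a b \<omega> s \<epsilon>) j"
    using ex1_part[OF assms] by blast
  then have "(THE j. t \<in> disjoint_parts (Pi' a b \<omega> s \<epsilon>) j) = j"
    using ex1_part[OF assms] by (intro the1_equality)
  then have "L_op a b \<omega> s \<epsilon> z t = z $ j"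
    using assms by (simp add: L_op_def)
  moreover have "tau \<omega> s \<epsilon> t = \<epsilon> $ j + \<omega> \<bar>t - s j\<bar>"
    using j by (simp add: disjoint_parts_eq Pi'_def)
  ultimately show thesis by (rule that)
qed

lemma L_op_eq_sum:
  assumes "t \<in> {a..b}"
  shows "L_op a b \<omega> s \<epsilon> z t = (\<Sum>j\<in>UNIV. z $ j * indicator (disjoint_parts (Pi' a b \<omega> s \<epsilon>) j) t)"
proof -
  obtain j where j: "t \<in> disjoint_parts (Pi' a b \<omega> s \<epsilon>) k \<longleftrightarrow> k = j" for k
    using ex1_part[OF assms, of \<omega> s \<epsilon>] by metis
  then show ?thesis
    using assms by (simp add: L_op_def indicator_def if_distrib[of "\<lambda>x. _ * x"] cong: if_cong)
qed

text \<open>Each \<open>Pi'\<close> is the set where two continuous functions coincide, so the parts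
  are measurable; on the interval all values are coordinates of \<open>z\<close>.\<close>

lemma L_op_B_space:
  assumes "modulus_of_continuity \<omega>"
  shows "L_op a b \<omega> s \<epsilon> z \<in> B_space a b"
proof -
  let ?M = "lebesgue_on {a..b}"
  have cont: "continuous_on {a..b} (\<lambda>t. \<epsilon> $ j + \<omega> \<bar>t - s j\<bar>)" for j
    by (intro continuous_intros continuous_on_modulus assms)
  have meas: "(\<lambda>t. \<epsilon> $ j + \<omega> \<bar>t - s j\<bar>) \<in> borel_measurable ?M" for j
    by (intro continuous_imp_measurable_on_sets_lebesgue cont) simp
  have tau: "tau \<omega> s \<epsilon> \<in> borel_measurable ?M"
    by (intro continuous_imp_measurable_on_sets_lebesgue H_class_continuous_on[OF assms]
        tau_H_class assms) simp
  have "Pi' a b \<omega> s \<epsilon> j = {t \<in> space ?M. tau \<omega> s \<epsilon> t = \<epsilon> $ j + \<omega> \<bar>t - s j\<bar>}" for j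
    by (simp add: Pi'_def space_lebesgue_on)
  also have "\<dots> j \<in> sets ?M" for j
    using tau meas by (rule borel_measurable_eq)
  finally have "Pi' a b \<omega> s \<epsilon> j \<in> sets ?M" for j .
  then have "disjoint_parts (Pi' a b \<omega> s \<epsilon>) j \<in> sets ?M" for j
    unfolding disjoint_parts_eq by (intro sets.Diff sets.finite_UN) auto
  then have "(\<lambda>t. \<Sum>j\<in>UNIV. z $ j * indicator (disjoint_parts (Pi' a b \<omega> s \<epsilon>) j) t)
      \<in> borel_measurable ?M"
    by measurable
  then have "L_op a b \<omega> s \<epsilon> z \<in> borel_measurable ?M"
    by (rule measurable_cong[THEN iffD1, rotated]) (simp add: L_op_eq_sum space_lebesgue_on)
  moreover have "\<bar>L_op a b \<omega> s \<epsilon> z t\<bar> \<le> norm z" if t: "t \<in> {a..b}" for t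
  proof -
    obtain j where "L_op a b \<omega> s \<epsilon> z t = z $ j"
      by (rule L_op_eq[OF t])
    then show ?thesis
      using component_le_norm_cart[of z j] by simp
  qed
  then have "AE t in ?M. \<bar>L_op a b \<omega> s \<epsilon> z t\<bar> \<le> norm z"
    by (intro AE_I2) (simp add: space_lebesgue_on)
  ultimately show ?thesis
    unfolding B_space_def by blast
qed

lemma abs_diff_L_op_le:
  assumes "x \<in> H_class a b \<omega>" and "range s \<subseteq> {a..b}" and "t \<in> {a..b}"
    and z: "\<And>j. \<bar>z $ j - x (s j)\<bar> \<le> \<epsilon> $ j"
  shows "\<bar>x t - L_op a b \<omega> s \<epsilon> z t\<bar> \<le> tau \<omega> s \<epsilon> t"
proof -
  obtain j where "L_op a b \<omega> s \<epsilon> z t = z $ j" and "tau \<omega> s \<epsilon> t = \<epsilon> $ j + \<omega> \<bar>t - s j\<bar>"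
    by (rule L_op_eq[OF assms(3)])
  moreover have "\<bar>x t - x (s j)\<bar> \<le> \<omega> \<bar>t - s j\<bar>"
    using assms(1-3) unfolding H_class_def by blast
  ultimately show ?thesis
    using z[of j] by linarith
qed

section \<open>Norms on lattices of functions\<close>

text \<open>The modulus in a lattice \<open>Y\<close> is a supremum relative to \<open>Y\<close>; boundedness of \<open>x\<close> guarantees
  that the pointwise \<open>|x|\<close> belongs to \<open>Y\<close> and hence is that supremum.\<close>

lemma normed_lattice_norm_mono:
  assumes "normed_lattice a b Y N" and "B_space a b \<subseteq> Y"
    and "x \<in> B_space a b" and "y \<in> B_space a b"
    and le: "\<And>t. t \<in> {a..b} \<Longrightarrow> \<bar>x t\<bar> \<le> y t"
  shows "N x \<le> N y"
proof -
  have sup: "is_sup a b Y u (\<lambda>t. - u t) (\<lambda>t. \<bar>u t\<bar>)" if "u \<in> B_space a b" for u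
  proof -
    have "AE t in lebesgue_on {a..b}. \<bar>u t\<bar> \<le> w t"
      if "AE t in lebesgue_on {a..b}. u t \<le> w t" "AE t in lebesgue_on {a..b}. - u t \<le> w t" for w
      using that by eventually_elim auto
    then show ?thesis
      using B_space_abs[OF \<open>u \<in> B_space a b\<close>] assms(2) by (auto simp: is_sup_def le_ae_def)
  qed
  have "le_ae a b (\<lambda>t. \<bar>x t\<bar>) (\<lambda>t. \<bar>y t\<bar>)"
    unfolding le_ae_def using le by (intro AE_I2) (force simp: space_lebesgue_on)
  moreover have "x \<in> Y" and "y \<in> Y"
    using assms(2-4) by auto
  moreover have "\<forall>x\<in>Y. \<forall>y\<in>Y. \<forall>x' y'. is_sup a b Y x (\<lambda>t. - x t) x' \<and>
      is_sup a b Y y (\<lambda>t. - y t) y' \<and> le_ae a b x' y' \<longrightarrow> N x \<le> N y"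
    using assms(1) unfolding normed_lattice_def by (elim conjE)
  ultimately show ?thesis
    using sup[OF assms(3)] sup[OF assms(4)] by blast
qed

lemma prod_norm_mono:
  assumes "monotone_norm \<psi>" and "\<And>i. normed_lattice a b (Y i) (N i)"
    and "\<And>i. B_space a b \<subseteq> Y i"
    and "\<And>i. x i \<in> B_space a b" and "\<And>i. y i \<in> B_space a b"
    and "\<And>i t. t \<in> {a..b} \<Longrightarrow> \<bar>x i t\<bar> \<le> y i t"
  shows "prod_norm N \<psi> x \<le> prod_norm N \<psi> y"
proof -
  \<comment> \<open>Monotonicity of \<open>\<psi>\<close> compares only vectors with non-negative
    entries.\<close>
  have "0 \<le> N i (x i)" for i
    using assms(2,3)[of i] assms(4)[of i] unfolding normed_lattice_def by blast
  moreover have "N i (x i) \<le> N i (y i)" for i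
    using assms(6) by (rule normed_lattice_norm_mono[OF assms(2,3,4,5)])
  ultimately show ?thesis
    using assms(1) by (simp add: prod_norm_def monotone_norm_def)
qed

text \<open>The identity \<open>2 * f = (f - g) - (- f - g)\<close> is behind this. Whatever
  \<open>g\<close> a method returns, it misses \<open>f\<close> or \<open>- f\<close> by at least
  the norm of \<open>f\<close>.\<close>

lemma prod_norm_two_point:
  assumes "monotone_norm \<psi>" and lat: "\<And>i. normed_lattice a b (Y i) (N i)"
    and f: "\<And>i. f i \<in> Y i" and g: "\<And>i. g i \<in> Y i"
  shows "2 * prod_norm N \<psi> f
    \<le> prod_norm N \<psi> (\<lambda>i t. f i t - g i t) + prod_norm N \<psi> (\<lambda>i t. - f i t - g i t)"
proof -
  \<comment> \<open>Since \<open>g\<close> may be unbounded, membership of the differences comes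
    from the vector space axioms of \<open>Y i\<close> and not from \<open>B_space\<close>.\<close>
  have scale: "(\<lambda>t. c * x t) \<in> Y i" "N i (\<lambda>t. c * x t) = \<bar>c\<bar> * N i x" if "x \<in> Y i" for c x i
    using lat[of i] that unfolding normed_lattice_def by blast+
  have add: "(\<lambda>t. x t + y t) \<in> Y i" "N i (\<lambda>t. x t + y t) \<le> N i x + N i y"
    if "x \<in> Y i" "y \<in> Y i" for x y i
    using lat[of i] that unfolding normed_lattice_def by blast+
  have nonneg: "0 \<le> N i x" if "x \<in> Y i" for x i
    using lat[of i] that unfolding normed_lattice_def by blast
  have norm: "\<psi> (c *\<^sub>R \<alpha>) = \<bar>c\<bar> * \<psi> \<alpha>" "\<psi> (\<alpha> + \<beta>) \<le> \<psi> \<alpha> + \<psi> \<beta>" for c \<alpha> \<beta>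
    using assms(1) by (simp_all add: monotone_norm_def is_norm_def)
  have diff: "(\<lambda>t. x t - g i t) \<in> Y i" if "x \<in> Y i" for x i
    using add(1)[OF that scale(1)[OF g, of "-1"]] by simp
  have minus_f: "(\<lambda>t. - f i t) \<in> Y i" for i
    using scale(1)[OF f, of "-1"] by simp
  have "2 * N i (f i) \<le> N i (\<lambda>t. f i t - g i t) + N i (\<lambda>t. - f i t - g i t)" for i
  proof -
    have eq: "(\<lambda>t. 2 * f i t) = (\<lambda>t. (f i t - g i t) + (-1) * (- f i t - g i t))"
      by (simp add: fun_eq_iff)
    have "2 * N i (f i) = N i (\<lambda>t. 2 * f i t)"
      using scale(2)[OF f[of i], of 2] by simp
    also have "\<dots> \<le> N i (\<lambda>t. f i t - g i t) + N i (\<lambda>t. (-1) * (- f i t - g i t))"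
      unfolding eq by (rule add(2)[OF diff[OF f] scale(1)[OF diff[OF minus_f]]])
    also have "N i (\<lambda>t. (-1) * (- f i t - g i t)) = N i (\<lambda>t. - f i t - g i t)"
      using scale(2)[OF diff[OF minus_f[of i]], of "-1"] by simp
    finally show ?thesis .
  qed
  \<comment> \<open>Monotonicity of \<open>\<psi>\<close> carries the coordinatewise estimates over;
    its own triangle inequality then separates the two errors.\<close>
  then have "\<psi> (2 *\<^sub>R (\<chi> i. N i (f i)))
      \<le> \<psi> ((\<chi> i. N i (\<lambda>t. f i t - g i t)) + (\<chi> i. N i (\<lambda>t. - f i t - g i t)))"
    using assms(1) nonneg[OF f] by (simp add: monotone_norm_def)
  also have "\<dots> \<le> \<psi> (\<chi> i. N i (\<lambda>t. f i t - g i t)) + \<psi> (\<chi> i. N i (\<lambda>t. - f i t - g i t))"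
    by (rule norm)
  finally show ?thesis
    by (simp add: prod_norm_def norm)
qed

section \<open>Optimal recovery\<close>

theorem corollary5:
  fixes S :: "real^'d::finite^'d" and a b :: real
    and \<omega> :: "'d \<Rightarrow> real \<Rightarrow> real"
    and s :: "'n::{finite,linorder} \<Rightarrow> real"
    and e :: "real^'d" and \<epsilon> :: "real^('n::{finite,linorder})^'d"
    and Y :: "'d \<Rightarrow> (real \<Rightarrow> real) set" and N :: "'d \<Rightarrow> (real \<Rightarrow> real) \<Rightarrow> real"
    and \<psi> :: "real^'d \<Rightarrow> real"
  assumes "ess_nonneg S"
    and "a < b"
    and "\<And>i. modulus_of_continuity (\<omega> i)"
    and "inj s" and "range s \<subseteq> {a..b}"
    and "\<And>i. 0 \<le> e $ i"
    and "\<And>i j. 0 \<le> \<epsilon> $ i $ j"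
    and "\<And>i. normed_lattice a b (Y i) (N i)"
    and "\<And>i. B_space a b \<subseteq> Y i"
    and "monotone_norm \<psi>"
  defines "A \<equiv> A_bar S a b"
    and "W \<equiv> W_bar a b \<omega>"
    and "I \<equiv> I_bar s"
    and "U \<equiv> U_bar e \<epsilon>"
    and "\<Phi> \<equiv> A_bar S a b \<circ> L_bar a b \<omega> s \<epsilon>"
    and "nrm \<equiv> prod_norm N \<psi>"
  shows "optimal_method Y nrm A W I U \<Phi> \<and>
    optimal_error Y nrm A W I U = method_error nrm A W I U \<Phi> \<and>
    method_error nrm A W I U \<Phi> = ereal (nrm (A (e, tau2 \<omega> s \<epsilon>))) \<and>
    nrm (A (e, tau2 \<omega> s \<epsilon>)) =
      nrm (\<lambda>i t. B_bar S a e i t + C_bar S a b (tau2 \<omega> s \<epsilon>) i t)"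
proof -
  note mod = assms(3) and range_s = assms(5) and e_nonneg = assms(6) and \<epsilon>_nonneg = assms(7)
    and lat = assms(8) and B_Y = assms(9) and mono = assms(10)
  let ?\<tau> = "tau2 \<omega> s \<epsilon>"
  have tau_H: "?\<tau> i \<in> H_class a b (\<omega> i)" for i
    unfolding tau2_def by (rule tau_H_class[OF mod])
  then have tau_B: "?\<tau> i \<in> B_space a b" for i
    by (rule subsetD[OF H_class_subset_B_space[OF mod]])
  have A_tau_B: "A (e, ?\<tau>) i \<in> B_space a b" for i
    unfolding A_def by (rule A_bar_B_space[OF tau_B])
  have L_B: "snd (L_bar a b \<omega> s \<epsilon> z) i \<in> B_space a b" for z i
    by (cases z) (simp add: L_bar_def L_op_B_space[OF mod])
  have \<Phi>_B: "\<Phi> z i \<in> B_space a b" for z i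
    unfolding \<Phi>_def o_def by (subst prod.collapse[symmetric]) (rule A_bar_B_space[OF L_B])
  have \<Phi>_methods: "\<Phi> \<in> methods Y"
    unfolding methods_def prod_space_def using subsetD[OF B_Y \<Phi>_B] by simp

  have upper: "method_error nrm A W I U \<Phi> \<le> ereal (nrm (A (e, ?\<tau>)))"
    unfolding method_error_def
  proof (intro SUP_least)
    fix x z assume "x \<in> W" and z: "z \<in> (\<lambda>u. I x + u) ` U"
    obtain p q where x: "x = (p, q)" by fastforce
    have q: "q i \<in> H_class a b (\<omega> i)" for i
      using \<open>x \<in> W\<close> by (simp add: x W_def W_bar_def)
    then have q_B: "q i \<in> B_space a b" for i
      using H_class_subset_B_space[OF mod, of a b i] by blast
    from z obtain u v where uv: "(u, v) \<in> U" and "z = I x + (u, v)" by auto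
    then have z: "z = (p + u, (\<chi> i. sample s (q i)) + v)"
      by (simp add: x I_def I_bar_def)
    \<comment> \<open>The noisy samples are \<open>w\<close> and their piecewise constant
      reconstruction is \<open>l\<close>; the method applies the exact operator to
      \<open>(p + u, l)\<close>.\<close>
    define w where "w = (\<chi> i. sample s (q i)) + v"
    define l where "l = (\<lambda>i. L_op a b (\<omega> i) s (\<epsilon> $ i) (w $ i))"
    have l_B: "l i \<in> B_space a b" for i
      unfolding l_def by (rule L_op_B_space[OF mod])
    have \<Phi>_z: "\<Phi> z = A_bar S a b (p + u, l)"
      by (simp add: \<Phi>_def z L_bar_def l_def w_def)
    have u: "\<bar>u $ i\<bar> \<le> e $ i" for i
      using uv by (auto simp: U_def U_bar_def mem_box_cart abs_le_iff minus_le_iff)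
    have "\<bar>v $ i $ j\<bar> \<le> \<epsilon> $ i $ j" for i j
      using uv by (auto simp: U_def U_bar_def mem_box_cart abs_le_iff minus_le_iff)
    then have w: "\<bar>w $ i $ j - q i (s j)\<bar> \<le> \<epsilon> $ i $ j" for i j
      by (simp add: w_def sample_def)
    have "\<bar>A x i t - \<Phi> z i t\<bar> \<le> A (e, ?\<tau>) i t" if t: "t \<in> {a..b}" for i t
    proof -
      \<comment> \<open>By linearity the error is the image of the data error, whose two components
        are bounded by \<open>e\<close> and \<open>tau2\<close>.\<close>
      have "A x i t - \<Phi> z i t = A_bar S a b (p - (p + u), \<lambda>j u. q j u - l j u) i t"
        unfolding A_def x \<Phi>_z using t by (intro A_bar_diff q_B l_B) simp
      also have "\<bar>\<dots>\<bar> \<le> A_bar S a b (e, ?\<tau>) i t"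
        using t u assms(1) abs_diff_L_op_le[OF q range_s _ w]
        by (intro abs_A_bar_le B_space_diff q_B l_B tau_B) (auto simp: tau2_def l_def)
      finally show ?thesis by (simp add: A_def)
    qed
    moreover have "(\<lambda>t. A x i t - \<Phi> z i t) \<in> B_space a b" for i
      unfolding A_def x using A_bar_B_space[OF q_B] \<Phi>_B by (rule B_space_diff)
    ultimately show "ereal (nrm (\<lambda>i t. A x i t - \<Phi> z i t)) \<le> ereal (nrm (A (e, ?\<tau>)))"
      unfolding nrm_def using A_tau_B
      by (auto intro!: prod_norm_mono[OF mono lat B_Y])
  qed

  have lower: "ereal (nrm (A (e, ?\<tau>))) \<le> optimal_error Y nrm A W I U"
    unfolding optimal_error_def
  proof (rule INF_greatest)
    fix \<Psi> :: "(real^'d) \<times> (real^('n::{finite,linorder})^'d) \<Rightarrow> 'd \<Rightarrow> real \<Rightarrow> real"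
    assume "\<Psi> \<in> methods Y"
    then have \<Psi>: "\<Psi> 0 i \<in> Y i" for i
      unfolding methods_def prod_space_def by blast
    \<comment> \<open>The noise \<open>- I x\<close> cancels the information, so the method must
      give the same answer \<open>\<Psi> 0\<close> for all such \<open>x\<close>.\<close>
    have error: "ereal (nrm (\<lambda>i t. A x i t - \<Psi> 0 i t)) \<le> method_error nrm A W I U \<Psi>"
      if "x \<in> W" "- I x \<in> U" for x
      unfolding method_error_def
    proof (rule SUP_upper2[OF \<open>x \<in> W\<close> SUP_upper])
      show "0 \<in> (\<lambda>u. I x + u) ` U"
        using \<open>- I x \<in> U\<close> by (rule image_eqI[rotated]) simp
    qed
    let ?\<tau>' = "\<lambda>i t. - ?\<tau> i t"
    \<comment> \<open>These bounds, and the weaker ones in \<open>bound\<close>, place the samples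
      of \<open>tau2\<close> with either sign in the noise boxes.\<close>
    have sample: "0 \<le> ?\<tau> i (s j)" "?\<tau> i (s j) \<le> \<epsilon> $ i $ j" for i j
      unfolding tau2_def using tau_nonneg[OF mod \<epsilon>_nonneg] tau_sample_le[OF mod] by auto
    have bound: "- (\<epsilon> $ i $ j) \<le> ?\<tau> i (s j)" "- ?\<tau> i (s j) \<le> \<epsilon> $ i $ j" for i j
      using sample(1)[of i j] \<epsilon>_nonneg[of i j] by linarith+
    have e: "- (e $ i) \<le> e $ i" for i
      using e_nonneg[of i] by simp
    have W: "(e, ?\<tau>) \<in> W" "(- e, ?\<tau>') \<in> W"
      using tau_H H_class_uminus[OF tau_H] by (simp_all add: W_def W_bar_def)
    have U: "- I (e, ?\<tau>) \<in> U" "- I (- e, ?\<tau>') \<in> U"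
      using e sample bound
      by (auto simp: I_def I_bar_def U_def U_bar_def mem_box_cart sample_def)
    have "2 * nrm (A (e, ?\<tau>)) \<le> nrm (\<lambda>i t. A (e, ?\<tau>) i t - \<Psi> 0 i t)
        + nrm (\<lambda>i t. - A (e, ?\<tau>) i t - \<Psi> 0 i t)"
      unfolding nrm_def by (rule prod_norm_two_point[OF mono lat subsetD[OF B_Y A_tau_B] \<Psi>])
    also have "(\<lambda>i t. - A (e, ?\<tau>) i t - \<Psi> 0 i t) = (\<lambda>i t. A (- e, ?\<tau>') i t - \<Psi> 0 i t)"
      by (simp add: A_def A_bar_uminus)
    \<comment> \<open>A sum of two errors that reaches twice the norm has a summand that reaches the
      norm.\<close>
    finally consider "nrm (A (e, ?\<tau>)) \<le> nrm (\<lambda>i t. A (e, ?\<tau>) i t - \<Psi> 0 i t)"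
      | "nrm (A (e, ?\<tau>)) \<le> nrm (\<lambda>i t. A (- e, ?\<tau>') i t - \<Psi> 0 i t)"
      by linarith
    then show "ereal (nrm (A (e, ?\<tau>))) \<le> method_error nrm A W I U \<Psi>"
      by cases (auto intro: order_trans[OF _ error[OF W(1) U(1)]] order_trans[OF _ error[OF W(2) U(2)]])
  qed

  have "optimal_error Y nrm A W I U \<le> method_error nrm A W I U \<Phi>"
    unfolding optimal_error_def using \<Phi>_methods by (rule INF_lower)
  with upper lower have "method_error nrm A W I U \<Phi> = ereal (nrm (A (e, ?\<tau>)))"
    and "optimal_error Y nrm A W I U = method_error nrm A W I U \<Phi>"
    by order+
  then show ?thesis
    using \<Phi>_methods by (simp add: optimal_method_def) (simp add: A_def A_bar_def)
qed

end
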